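(* Let $n\ge 1$ be an integer, let $\Omega\neq\mathbb{C}$ be a simply connected domain in $\mathbb{C}$, let $h$ be a conformal mapping of $\mathbb{D}$ onto $\Omega$, let $q\in Q$ with $q(0)=a$, and let $\beta$ be a real number with $0<\beta\le|q'(0)|$. Let $\psi\in\Psi_{n,\beta}(h,q)$ with associated domain $D\subset\mathbb{C}^3$, and let $p\in\mathcal{H}_\beta[a,n]$. If $(p(z),zp'(z),z^2p''(z))\in D$ for all $z\in\mathbb{D}$ and $$\psi(p(z),zp'(z),z^2p''(z))\prec h(z)\qquad(z\in\mathbb{D}),$$ then $p\prec q$.
   Context: $\mathbb{D}=\{z\in\mathbb{C}:|z|<1\}$. For $a\in\mathbb{C}$, a positive integer $n$ and a fixed real $\beta\ge 0$, $\mathcal{H}_\beta[a,n]$ is the class of analytic functions $p$ in $\mathbb{D}$ of the form $p(z)=a+\beta z^n+p_{n+1}z^{n+1}+\cdots$. For functions $F,G$ analytic in $\mathbb{D}$, $F\prec G$ ($F$ is subordinate to $G$) means that there is an analytic $w:\mathbb{D}\to\mathbb{D}$ with $w(0)=0$ and $F=G\circ w$ on $\mathbb{D}$; for $G$ univalent this is equivalent to $F(0)=G(0)$ and $F(\mathbb{D})\subset G(\mathbb{D})$. $Q$ is the class of functions $q$ that are analytic and injective on $\overline{\mathbb{D}}\setminus E(q)$, where $E(q)=\{\zeta\in\partial\mathbb{D}:\lim_{z\to\zeta}q(z)=\infty\}$, and are such that $q'(\zeta)\ne 0$ for $\zeta\in\partial\mathbb{D}\setminus E(q)$. $\beta$-admissibility: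 for a domain $\Omega\subset\mathbb{C}$, $q\in Q$ and $\beta\le|q'(0)|$, the class $\Psi_{n,\beta}(\Omega,q)$ consists of the functions $\psi:\mathbb{C}^3\to\mathbb{C}$ satisfying: (i) $\psi(r,s,t)$ is continuous in a domain $D\subset\mathbb{C}^3$ (the associated domain); (ii) $(q(0),0,0)\in D$ and $\psi(q(0),0,0)\in\Omega$; (iii) $\psi(r_0,s_0,t_0)\notin\Omega$ whenever $(r_0,s_0,t_0)\in D$, $r_0=q(\zeta)$, $s_0=m\zeta q'(\zeta)$ and $$\operatorname{Re}\left(\frac{t_0}{s_0}+1\right)\ge m\operatorname{Re}\left(\frac{\zeta q''(\zeta)}{q'(\zeta)}+1\right),$$ where $|\zeta|=1$, $q(\zeta)$ is finite (i.e. $\zeta\notin E(q)$), and $m$ is a real number with $m\ge n+\dfrac{|q'(0)|-\beta}{|q'(0)|+\beta}$. For $h$ a conformal mapping of $\mathbb{D}$ onto a simply connected domain $\Omega\ne\mathbb{C}$, $\Psi_{n,\beta}(h,q)$ is the class of functions $\psi\in\Psi_{n,\beta}(\Omega,q)=\Psi_{n,\beta}(h(\mathbb{D}),q)$ which are analytic in their associated domains $D$ and satisfy $\psi(q(0),0,0)=h(0)$. *)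

theory Defs
  imports "HOL-Complex_Analysis.Complex_Analysis"
begin

abbreviation unit_disc :: "complex set" where
  "unit_disc \<equiv> ball 0 1"

definition is_domain :: "'a::topological_space set \<Rightarrow> bool" where
  "is_domain S \<longleftrightarrow> open S \<and> connected S \<and> S \<noteq> {}"

definition conformal_map_onto :: "(complex \<Rightarrow> complex) \<Rightarrow> complex set \<Rightarrow> bool" where
  "conformal_map_onto h \<Omega> \<longleftrightarrow>
     h holomorphic_on unit_disc \<and> inj_on h unit_disc \<and> h ` unit_disc = \<Omega>"

definition subordinate :: "(complex \<Rightarrow> complex) \<Rightarrow> (complex \<Rightarrow> complex) \<Rightarrow> bool"
    (infix "\<prec>\<^sub>s" 50) where
  "F \<prec>\<^sub>s G \<longleftrightarrow> F holomorphic_on unit_disc \<and> G holomorphic_on unit_disc \<and>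
     (\<exists>w. w holomorphic_on unit_disc \<and> w ` unit_disc \<subseteq> unit_disc \<and> w 0 = 0 \<and>
          (\<forall>z\<in>unit_disc. F z = G (w z)))"

definition class_H :: "real \<Rightarrow> complex \<Rightarrow> nat \<Rightarrow> (complex \<Rightarrow> complex) set" where
  "class_H \<beta> a n = {p. p holomorphic_on unit_disc \<and>
     (\<exists>c :: nat \<Rightarrow> complex. \<forall>z\<in>unit_disc.
        (\<lambda>k. c k * z ^ (n + 1 + k)) sums (p z - (a + of_real \<beta> * z ^ n)))}"

text \<open>The limit defining the exceptional set is taken from inside the disc, so that it does not
  depend on the (arbitrary) values of the total function \<open>q\<close> outside the disc.\<close>

definition exceptional_set :: "(complex \<Rightarrow> complex) \<Rightarrow> complex set" where
  "exceptional_set q =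
     {\<zeta> \<in> sphere 0 1. filterlim q at_infinity (at \<zeta> within unit_disc)}"

definition class_Q :: "(complex \<Rightarrow> complex) set" where
  "class_Q = {q. q analytic_on (cball 0 1 - exceptional_set q) \<and>
                 inj_on q (cball 0 1 - exceptional_set q) \<and>
                 (\<forall>\<zeta> \<in> sphere 0 1 - exceptional_set q. deriv q \<zeta> \<noteq> 0)}"

text \<open>Analyticity of a function of three complex variables on an open set: at each point the
  function is totally differentiable with a complex-linear differential.\<close>

definition analytic3_on ::
    "(complex \<times> complex \<times> complex \<Rightarrow> complex) \<Rightarrow> (complex \<times> complex \<times> complex) set \<Rightarrow> bool" where
  "analytic3_on \<psi> D \<longleftrightarrow>
     (\<forall>x\<in>D. \<exists>A B C. (\<psi> has_derivative (\<lambda>(u, v, w). A * u + B * v + C * w)) (at x))"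

text \<open>The associated domain \<open>D\<close> is an explicit parameter of both admissibility classes.\<close>

definition admissible_class ::
    "nat \<Rightarrow> real \<Rightarrow> complex set \<Rightarrow> (complex \<Rightarrow> complex) \<Rightarrow> (complex \<times> complex \<times> complex) set \<Rightarrow>
     (complex \<times> complex \<times> complex \<Rightarrow> complex) set" where
  "admissible_class n \<beta> \<Omega> q D = {\<psi>.
     is_domain D \<and> continuous_on D \<psi> \<and>
     (q 0, 0, 0) \<in> D \<and> \<psi> (q 0, 0, 0) \<in> \<Omega> \<and>
     (\<forall>r s t \<zeta>. \<forall>m::real.
        (r, s, t) \<in> D \<and> \<zeta> \<in> sphere 0 1 - exceptional_set q \<and>
        m \<ge> real n + (norm (deriv q 0) - \<beta>) / (norm (deriv q 0) + \<beta>) \<and>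
        r = q \<zeta> \<and> s = of_real m * \<zeta> * deriv q \<zeta> \<and>
        Re (t / s + 1) \<ge> m * Re (\<zeta> * deriv (deriv q) \<zeta> / deriv q \<zeta> + 1)
        \<longrightarrow> \<psi> (r, s, t) \<notin> \<Omega>)}"

definition admissible_class_conformal ::
    "nat \<Rightarrow> real \<Rightarrow> (complex \<Rightarrow> complex) \<Rightarrow> (complex \<Rightarrow> complex) \<Rightarrow>
     (complex \<times> complex \<times> complex) set \<Rightarrow> (complex \<times> complex \<times> complex \<Rightarrow> complex) set" where
  "admissible_class_conformal n \<beta> h q D =
     {\<psi> \<in> admissible_class n \<beta> (h ` unit_disc) q D.
        analytic3_on \<psi> D \<and> \<psi> (q 0, 0, 0) = h 0}"

end

theory Submission
  imports Defs
begin

text \<open>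
  If \<open>p(D)\<close> is not contained in \<open>q(D)\<close>, take \<open>z\<^sub>0\<close> of least modulus with
  \<open>p(z\<^sub>0) \<notin> q(D)\<close>. On the disc \<open>|z| < |z\<^sub>0|\<close> the function \<open>w = q\<^sup>-\<^sup>1 \<circ> p\<close> maps into \<open>D\<close>, and
  injectivity of \<open>q\<close> on the closed disc forces \<open>w(z) \<rightarrow> \<zeta>\<close> as \<open>z \<rightarrow> z\<^sub>0\<close> for one boundary point
  \<open>\<zeta>\<close> outside the exceptional set; a local inverse of \<open>q\<close> at \<open>q(\<zeta>)\<close> then continues \<open>w\<close>
  analytically across \<open>z\<^sub>0\<close>. Since \<open>|w|\<close> is maximal on the circle at \<open>z\<^sub>0\<close>, the number
  \<open>m = z\<^sub>0 w'(z\<^sub>0) / w(z\<^sub>0)\<close> is real and \<open>Re (z\<^sub>0 w''(z\<^sub>0) / w'(z\<^sub>0) + 1) \<ge> m\<close>. Moreover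
  \<open>w(z) = z\<^sup>n \<phi>(z)\<close> with \<open>\<phi>(0) = \<beta> / q'(0)\<close>, and the Schwarz-Pick bound for \<open>\<phi>\<close> gives the lower
  bound on \<open>m\<close>. Differentiating \<open>p = q \<circ> w\<close> twice shows that the admissibility condition applies at
  \<open>z\<^sub>0\<close>, which contradicts \<open>\<psi>(p(z\<^sub>0), ...) \<in> h(D)\<close>.
\<close>

section \<open>Maxima of the modulus along a circle\<close>

text \<open>If \<open>L\<close> were positive, \<open>g'\<close> would be positive just to the right
  of 0, so \<open>g\<close> would increase there and exceed \<open>g 0\<close>. The second
  derivative is asked for at 0 only.\<close>

lemma second_derivative_nonpos_at_local_max:
  fixes g g' :: "real \<Rightarrow> real"
  assumes "d > 0"
    and der: "\<And>t. \<bar>t\<bar> < d \<Longrightarrow> (g has_real_derivative g' t) (at t)"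
    and der2: "(g' has_real_derivative L) (at 0)"
    and max: "\<And>t. \<bar>t\<bar> < d \<Longrightarrow> g t \<le> g 0"
  shows "g' 0 = 0" and "L \<le> 0"
proof -
  show g'0: "g' 0 = 0"
    using DERIV_local_max[OF der[of 0] \<open>d > 0\<close>] max \<open>d > 0\<close> by auto
  show "L \<le> 0"
  proof (rule ccontr)
    assume "\<not> L \<le> 0"
    then obtain e where e: "e > 0" "\<And>h. 0 < h \<Longrightarrow> h < e \<Longrightarrow> 0 < g' h"
      using DERIV_pos_inc_right[OF der2] g'0 by auto
    define b where "b = min d e / 2"
    have b: "0 < b" "b < d" "b < e" using \<open>d > 0\<close> e by (auto simp: b_def)
    have "g 0 < g b"
    proof (rule DERIV_pos_imp_increasing_open[OF b(1)])
      show "\<exists>y. (g has_real_derivative y) (at x) \<and> 0 < y" if "0 < x" "x < b" for x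
        using der[of x] e(2)[of x] that b by (intro exI[of _ "g' x"]) auto
      show "continuous_on {0..b} g"
        using der b by (intro continuous_at_imp_continuous_on ballI DERIV_isCont[OF der]) auto
    qed
    with max[of b] b show False by auto
  qed
qed

text \<open>The squared modulus of \<open>f\<close> along \<open>z0 * cis t\<close> has a local
  maximum at t = 0. Since d/dt acts as i z d/dz, its first two derivatives there are -2 Im (cnj f F)
  and 2 (|F|^2 - Re (cnj f F2)), where F = z f' and F2 = z F'. The first vanishes and the second is
  nonpositive.\<close>

lemma norm_max_on_circle:
  assumes "f holomorphic_on S" "open S" "z0 \<in> S"
    and max: "\<And>z. z \<in> S \<Longrightarrow> norm z = norm z0 \<Longrightarrow> norm (f z) \<le> norm (f z0)"
  shows "Im (cnj (f z0) * (z0 * deriv f z0)) = 0"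
    and "norm (z0 * deriv f z0) ^ 2 \<le>
           Re (cnj (f z0) * (z0 * deriv f z0 + z0\<^sup>2 * deriv (deriv f) z0))"
proof -
  define Z where "Z t = z0 * cis t" for t
  have [simp]: "Z 0 = z0" by (simp add: Z_def)
  have dZ: "(Z has_vector_derivative \<i> * Z t) (at t)" for t
    unfolding Z_def cis_conv_exp has_vector_derivative_complex_iff
    by (auto intro!: derivative_eq_intros simp: Re_exp Im_exp algebra_simps)
  have "continuous (at 0) Z"
    using dZ has_vector_derivative_continuous by blast
  then have "eventually (\<lambda>t. Z t \<in> S) (at 0)"
    using assms(2,3) by (metis \<open>Z 0 = z0\<close> continuous_at_imp_continuous_at_within continuous_within topological_tendstoD)
  then obtain d where d: "d > 0" "\<And>t. \<bar>t\<bar> < d \<Longrightarrow> Z t \<in> S"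
    using assms(3) unfolding eventually_at by (metis \<open>Z 0 = z0\<close> dist_real_def diff_0_right UNIV_I)
  define F where "F = (\<lambda>z. z * deriv f z)"
  define F2 where "F2 = (\<lambda>z. z * deriv f z + z\<^sup>2 * deriv (deriv f) z)"
  have dF: "(F has_field_derivative deriv f z + z * deriv (deriv f) z) (at z)" if "z \<in> S" for z
    unfolding F_def
    using holomorphic_derivI[OF holomorphic_deriv[OF assms(1,2)] assms(2) that]
    by (auto intro!: derivative_eq_intros)
  have g1: "((f \<circ> Z) has_vector_derivative (\<i> * Z t) * deriv f (Z t)) (at t)" if "\<bar>t\<bar> < d" for t
    using field_vector_diff_chain_at[OF dZ holomorphic_derivI[OF assms(1,2) d(2)[OF that]]] .
  have g2: "((F \<circ> Z) has_vector_derivative (\<i> * Z t) * (deriv f (Z t) + Z t * deriv (deriv f) (Z t))) (at t)"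
    if "\<bar>t\<bar> < d" for t
    using field_vector_diff_chain_at[OF dZ dF[OF d(2)[OF that]]] .
  define g where "g t = (Re (f (Z t)))\<^sup>2 + (Im (f (Z t)))\<^sup>2" for t
  define g' where "g' t = 2 * (Im (f (Z t)) * Re (F (Z t)) - Re (f (Z t)) * Im (F (Z t)))" for t
  define L where "L = 2 * (Re (F z0) ^ 2 + Im (F z0) ^ 2 - Re (f z0) * Re (F2 z0) - Im (f z0) * Im (F2 z0))"
  note R1 = g1[unfolded has_vector_derivative_complex_iff o_def, THEN conjunct1]
  note I1 = g1[unfolded has_vector_derivative_complex_iff o_def, THEN conjunct2]
  note R2 = g2[unfolded has_vector_derivative_complex_iff o_def, THEN conjunct1]
  note I2 = g2[unfolded has_vector_derivative_complex_iff o_def, THEN conjunct2]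
  have der: "(g has_real_derivative g' t) (at t)" if "\<bar>t\<bar> < d" for t
    unfolding g_def g'_def
    by (rule R1[OF that] I1[OF that] derivative_eq_intros refl)+ (simp add: F_def algebra_simps)
  have d0: "\<bar>0\<bar> < d" using d by simp
  have der2: "(g' has_real_derivative L) (at 0)"
    unfolding g'_def L_def
    by (rule R1[OF d0] I1[OF d0] R2[OF d0] I2[OF d0] derivative_eq_intros refl)+
      (simp add: F_def F2_def algebra_simps power2_eq_square)
  have max': "g t \<le> g 0" if "\<bar>t\<bar> < d" for t
  proof -
    have "norm (f (Z t)) \<le> norm (f (Z 0))"
      using max[OF d(2)[OF that]] by (simp add: Z_def norm_mult)
    then have "norm (f (Z t)) ^ 2 \<le> norm (f (Z 0)) ^ 2" by (simp add: power_mono)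
    then show ?thesis by (simp add: g_def cmod_power2)
  qed
  have "g' 0 = 0"
    by (rule second_derivative_nonpos_at_local_max(1)[OF d(1) der der2 max'])
  moreover have "L \<le> 0"
    by (rule second_derivative_nonpos_at_local_max(2)[OF d(1) der der2 max'])
  ultimately show "Im (cnj (f z0) * (z0 * deriv f z0)) = 0"
    and "norm (z0 * deriv f z0) ^ 2 \<le>
           Re (cnj (f z0) * (z0 * deriv f z0 + z0\<^sup>2 * deriv (deriv f) z0))"
    by (auto simp: g'_def L_def F_def F2_def cmod_power2 algebra_simps)
qed

section \<open>Schwarz-Pick bounds and the radial derivative\<close>

text \<open>\<open>Schwarz_Lemma\<close> needs the strict bound |f| < 1, so it is applied to s f
  with 0 < s < 1, and then s tends to 1.\<close>

lemma Schwarz_Lemma_le: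
  assumes "f holomorphic_on ball 0 1" "f 0 = 0"
    and "\<And>z. norm z < 1 \<Longrightarrow> norm (f z) \<le> 1" "norm \<xi> < 1"
  shows "norm (f \<xi>) \<le> norm \<xi>"
proof -
  have "s * norm (f \<xi>) \<le> norm \<xi>" if "0 < s" "s < 1" for s :: real
  proof -
    have "norm (of_real s * f \<xi>) \<le> norm \<xi>"
    proof (rule Schwarz_Lemma(1))
      show "norm (of_real s * f z) < 1" if "norm z < 1" for z
      proof -
        have "s * norm (f z) \<le> s * 1"
          using assms(3)[OF that] \<open>0 < s\<close> by (intro mult_left_mono) auto
        also have "\<dots> < 1" using \<open>s < 1\<close> by simp
        finally show ?thesis using \<open>0 < s\<close> by (simp add: norm_mult)
      qed
    qed (use assms in \<open>auto intro!: holomorphic_intros\<close>)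
    then show ?thesis using that by (simp add: norm_mult)
  qed
  then show ?thesis
    by (rule field_le_mult_one_interval)
qed

text \<open>Composing \<open>f\<close> with the disc automorphism that sends \<open>f 0\<close> to 0
  reduces the bound to the Schwarz lemma. This gives it with |f 0| in place of \<open>c\<close>; the
  quotient (x + v) / (1 + v x) increases with v when 0 \<le> x < 1.\<close>

lemma Schwarz_Pick_norm:
  assumes hol: "f holomorphic_on ball 0 1"
    and le: "\<And>z. norm z < 1 \<Longrightarrow> norm (f z) \<le> 1"
    and c: "norm (f 0) \<le> c" "c \<le> 1" and z: "norm z < 1"
  shows "norm (f z) \<le> (norm z + c) / (1 + c * norm z)"
proof -
  have c0: "0 \<le> c" using c norm_ge_zero order_trans by blast
  define x where "x = norm z"
  have x: "0 \<le> x" "x < 1" using z by (auto simp: x_def)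
  define b where "b = f 0"
  define u v where "u = norm (f z)" and "v = norm b"
  have u: "0 \<le> u" "u \<le> 1" using le z by (auto simp: u_def)
  have v: "0 \<le> v" "v \<le> c" using c by (auto simp: v_def b_def)
  have main: "u * (1 + x * v) \<le> x + v"
  proof (cases "v < 1")
    case False
    then have "v = 1" using v c by auto
    moreover have "u * (1 + x) \<le> 1 * (1 + x)"
      using u x by (intro mult_right_mono) auto
    ultimately show ?thesis by simp
  next
    case True
    \<comment> \<open>Used twice: it shows that the automorphism maps the closed disc into itself,
      and it later eliminates \<open>norm (1 - cnj b * f z)\<close>.\<close>
    have id: "norm (1 - cnj b * y) ^ 2 - norm (y - b) ^ 2 = (1 - norm y ^ 2) * (1 - v ^ 2)" for y
      unfolding v_def cmod_power2 by (simp add: algebra_simps power2_eq_square)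
    have nz: "1 - cnj b * f y \<noteq> 0" if "norm y < 1" for y
    proof
      assume "1 - cnj b * f y = 0"
      then have "norm (cnj b * f y) = 1" by (metis norm_one right_minus_eq)
      then have "v * norm (f y) = 1" by (simp add: norm_mult v_def)
      moreover have "v * norm (f y) \<le> v * 1" using le[OF that] v by (intro mult_left_mono)
      ultimately show False using True by simp
    qed
    define F where "F y = (f y - b) / (1 - cnj b * f y)" for y
    have "norm (F z) \<le> norm z"
    proof (rule Schwarz_Lemma_le[OF _ _ _ z])
      show "F holomorphic_on ball 0 1"
        unfolding F_def using nz hol by (auto intro!: holomorphic_intros)
      show "F 0 = 0" by (simp add: F_def b_def)
      fix y :: complex assume y: "norm y < 1"
      have "0 \<le> (1 - norm (f y) ^ 2) * (1 - v ^ 2)"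
        using le[OF y] v True by (simp add: abs_square_le_1)
      then have "norm (f y - b) ^ 2 \<le> norm (1 - cnj b * f y) ^ 2" using id[of "f y"] by linarith
      then have "norm (f y - b) \<le> norm (1 - cnj b * f y)" by (rule power2_le_imp_le) simp
      then show "norm (F y) \<le> 1" using nz[OF y] by (simp add: F_def norm_divide)
    qed
    then have "norm (f z - b) \<le> x * norm (1 - cnj b * f z)"
      using nz[OF z] by (simp add: F_def norm_divide x_def field_simps)
    then have "norm (f z - b) ^ 2 \<le> (x * norm (1 - cnj b * f z)) ^ 2"
      by (simp add: power_mono)
    also have "\<dots> = x\<^sup>2 * (norm (f z - b) ^ 2 + (1 - u ^ 2) * (1 - v ^ 2))"
      using id[of "f z"] by (simp add: power_mult_distrib u_def)
    finally have "norm (f z - b) ^ 2 * (1 - x\<^sup>2) \<le> x\<^sup>2 * ((1 - u ^ 2) * (1 - v ^ 2))"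
      by (simp add: algebra_simps)
    \<comment> \<open>The reverse triangle inequality replaces the complex difference by a
      difference of moduli.\<close>
    moreover have "(u - v) ^ 2 \<le> norm (f z - b) ^ 2"
      using norm_triangle_ineq3[of "f z" b] by (metis abs_le_square_iff abs_norm_cancel u_def v_def)
    then have "(u - v) ^ 2 * (1 - x\<^sup>2) \<le> norm (f z - b) ^ 2 * (1 - x\<^sup>2)"
      using x by (intro mult_right_mono) (auto simp: abs_square_le_1)
    ultimately have "(u - v) ^ 2 * (1 - x\<^sup>2) \<le> x\<^sup>2 * ((1 - u ^ 2) * (1 - v ^ 2))" by linarith
    \<comment> \<open>This rests on (1 - u^2) (1 - v^2) = (1 - u v)^2 - (u - v)^2.\<close>
    then have "(u - v) ^ 2 \<le> (x * (1 - u * v)) ^ 2"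
      by (simp add: algebra_simps power2_eq_square)
    moreover have "0 \<le> x * (1 - u * v)" using u v True x by (simp add: mult_le_one)
    ultimately have "u - v \<le> x * (1 - u * v)" using power2_le_imp_le by blast
    then show ?thesis by (simp add: algebra_simps)
  qed
  have "u \<le> (x + c) / (1 + c * x)"
  proof -
    have "u \<le> (x + v) / (1 + v * x)"
      using main x v by (subst pos_le_divide_eq) (auto simp: algebra_simps add_pos_nonneg)
    also have "\<dots> \<le> (x + c) / (1 + c * x)"
    proof -
      have "0 \<le> (c - v) * (1 - x\<^sup>2)"
        using v x by (intro mult_nonneg_nonneg) (auto simp: abs_square_le_1)
      then have "(x + v) * (1 + c * x) \<le> (x + c) * (1 + v * x)"
        by (simp add: algebra_simps power2_eq_square)
      moreover have "0 < 1 + v * x" "0 < 1 + c * x"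
        using v x c0 by (auto intro!: add_pos_nonneg)
      ultimately show ?thesis by (simp add: divide_le_eq le_divide_eq field_simps)
    qed
    finally show ?thesis .
  qed
  then show ?thesis by (simp add: u_def x_def)
qed

text \<open>The real function \<open>u\<close> below is dominated by the bound \<open>v\<close> just
  left of 1, and both equal 1 at 1. Hence the derivative of \<open>u\<close> at 1 is at least that
  of \<open>v\<close>, which is n + (1 - c) / (1 + c).\<close>

lemma radial_derivative_lower_bound:
  fixes c :: real
  assumes "f holomorphic_on S" "open S" "z0 \<in> S" "norm (f z0) = 1" "0 \<le> c"
    and bound: "eventually (\<lambda>x. norm (f (of_real x * z0)) \<le> x ^ n * ((x + c) / (1 + c * x))) (at_left 1)"
  shows "real n + (1 - c) / (1 + c) \<le> Re (cnj (f z0) * (z0 * deriv f z0))"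
proof -
  define v where "v x = x ^ n * ((x + c) / (1 + c * x))" for x :: real
  define u where "u x = Re (cnj (f z0) * f (of_real x * z0))" for x :: real
  \<comment> \<open>The left-hand side is what the quotient rule yields at 1.\<close>
  have "(1 * (1 + c * 1) - (1 + c) * c) / ((1 + c * 1) * (1 + c * 1)) =
      ((1 + c) * (1 - c)) / ((1 + c) * (1 + c))"
    by (simp add: algebra_simps)
  also have "\<dots> = (1 - c) / (1 + c)" using \<open>0 \<le> c\<close> by simp
  finally have quot: "((\<lambda>x. (x + c) / (1 + c * x)) has_real_derivative (1 - c) / (1 + c)) (at 1)"
    using \<open>0 \<le> c\<close> by (auto intro!: derivative_eq_intros)
  have dv: "(v has_real_derivative real n + (1 - c) / (1 + c)) (at 1)"
    unfolding v_def using \<open>0 \<le> c\<close>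
    by - (rule derivative_eq_intros quot refl | simp)+
  have line: "((\<lambda>x. of_real x * z0) has_vector_derivative z0) (at 1)"
    by (auto intro!: derivative_eq_intros)
  have "((f \<circ> (\<lambda>x. of_real x * z0)) has_vector_derivative z0 * deriv f z0) (at (1::real))"
    by (rule field_vector_diff_chain_at[OF line]) (use holomorphic_derivI[OF assms(1,2,3)] in simp)
  then have "((\<lambda>x. cnj (f z0) * f (of_real x * z0)) has_vector_derivative
      cnj (f z0) * (z0 * deriv f z0)) (at (1::real))"
    by (auto intro!: derivative_eq_intros simp: o_def)
  then have du: "(u has_real_derivative Re (cnj (f z0) * (z0 * deriv f z0))) (at 1)"
    unfolding u_def has_vector_derivative_complex_iff by simp
  have u1: "u 1 = 1" using \<open>norm (f z0) = 1\<close>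
    unfolding u_def by (simp add: cmod_def flip: power2_eq_square)
  have v1: "v 1 = 1" using \<open>0 \<le> c\<close> by (simp add: v_def)
  show ?thesis
  proof (rule ccontr)
    assume "\<not> ?thesis"
    then have "Re (cnj (f z0) * (z0 * deriv f z0)) - (real n + (1 - c) / (1 + c)) < 0" by simp
    then obtain d where d: "d > 0" "\<And>h. h > 0 \<Longrightarrow> h < d \<Longrightarrow> u 1 - v 1 < u (1 - h) - v (1 - h)"
      using has_real_derivative_neg_dec_left[OF DERIV_diff[OF du dv]] by auto
    have "eventually (\<lambda>x. x \<in> {1 - d<..<1}) (at_left (1::real))"
      using d by (intro eventually_at_leftI[of "1 - d"]) auto
    then have "eventually (\<lambda>x. False) (at_left (1::real))"
      using bound
    proof eventually_elim
      case (elim x)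
      have "u x \<le> norm (cnj (f z0) * f (of_real x * z0))"
        unfolding u_def by (rule complex_Re_le_cmod)
      also have "\<dots> \<le> v x" using elim \<open>norm (f z0) = 1\<close> by (simp add: norm_mult v_def)
      finally show False using d(2)[of "1 - x"] elim u1 v1 by simp
    qed
    then show False by simp
  qed
qed

text \<open>After rescaling to the unit disc, the factor \<open>F\<close> is at most 1 / r^n on the
  circle of radius r, hence inside it by the maximum principle; letting r tend to 1 gives |F| \<le>
  1. Then \<open>Schwarz_Pick_norm\<close> applies to \<open>F\<close>.\<close>

lemma growth_bound_zero_order:
  assumes hol: "\<phi> holomorphic_on ball 0 R" and R: "0 < R" "R \<le> 1"
    and le: "\<And>z. norm z < R \<Longrightarrow> norm (z ^ n * \<phi> z) \<le> 1"
    and c: "norm (\<phi> 0) \<le> c" "c \<le> 1" and z: "norm z < R"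
  shows "norm (z ^ n * \<phi> z) \<le> (norm z / R) ^ n * ((norm z / R + c) / (1 + c * (norm z / R)))"
proof -
  define F where "F u = of_real R ^ n * \<phi> (of_real R * u)" for u
  have sub: "of_real R * u \<in> ball 0 R" if "norm u < 1" for u :: complex
    using that R by (simp add: norm_mult)
  have holF: "F holomorphic_on ball 0 1"
    unfolding F_def
    by (intro holomorphic_intros holomorphic_on_compose_gen[OF _ hol, unfolded o_def])
      (use sub in auto)
  have Fle: "norm (F \<xi>) \<le> 1" if \<xi>: "norm \<xi> < 1" for \<xi>
  proof -
    have "r ^ n * norm (F \<xi>) \<le> 1" if r: "norm \<xi> < r" "r < 1" for r
    proof -
      have r0: "0 < r" using r norm_ge_zero le_less_trans by blast
      have "norm (F \<xi>) \<le> 1 / r ^ n"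
      proof (rule maximum_modulus_frontier[of F "ball 0 r"])
        show "F holomorphic_on interior (ball 0 r)"
          using r by (auto intro: holomorphic_on_subset[OF holF])
        show "continuous_on (closure (ball 0 r)) F"
          using r r0 by (auto intro!: holomorphic_on_imp_continuous_on holomorphic_on_subset[OF holF])
        show "norm (F u) \<le> 1 / r ^ n" if "u \<in> frontier (ball 0 r)" for u
        proof -
          have u: "norm u = r" using that r0 by simp
          have "norm ((of_real R * u) ^ n * \<phi> (of_real R * u)) \<le> 1"
            using sub[of u] u r by (intro le) auto
          then show ?thesis using r0 u
            by (simp add: F_def norm_mult norm_power power_mult_distrib field_simps)
        qed
      qed (use r r0 in auto)
      then show ?thesis using r0 by (simp add: field_simps)
    qed
    then have "eventually (\<lambda>r. r ^ n * norm (F \<xi>) \<le> 1) (at_left 1)"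
      using \<xi> by (intro eventually_at_leftI[of "norm \<xi>"]) auto
    moreover have "((\<lambda>r. r ^ n * norm (F \<xi>)) \<longlongrightarrow> 1 ^ n * norm (F \<xi>)) (at_left 1)"
      by (intro tendsto_intros)
    ultimately show ?thesis
      using tendsto_upperbound[of "\<lambda>r. r ^ n * norm (F \<xi>)" _ "at_left 1" 1] by simp
  qed
  \<comment> \<open>Rescaling multiplies the value at 0 by R^n \<le> 1, so \<open>c\<close> remains
    an upper bound for it, though possibly no longer its modulus.\<close>
  have "R ^ n * norm (\<phi> 0) \<le> 1 * norm (\<phi> 0)"
    using R by (intro mult_right_mono power_le_one) auto
  then have "norm (F 0) \<le> norm (\<phi> 0)"
    using R by (simp add: F_def norm_mult norm_power)
  then have F0: "norm (F 0) \<le> c" using c by simp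
  have zR: "norm (z / of_real R) < 1" using z R by (simp add: norm_divide)
  have "norm (F (z / of_real R)) \<le> (norm z / R + c) / (1 + c * (norm z / R))"
    using Schwarz_Pick_norm[OF holF Fle F0 c(2) zR] R by (simp add: norm_divide)
  moreover have "norm (z ^ n * \<phi> z) = (norm z / R) ^ n * norm (F (z / of_real R))"
    using R by (simp add: F_def norm_mult norm_power power_divide)
  ultimately show ?thesis using R by (simp only:) (intro mult_left_mono, auto)
qed

section \<open>First exit from the image and boundary limits of the inverse branch\<close>

text \<open>The points of modulus at most |z1| that \<open>p\<close> sends outside \<open>U\<close>
  form a nonempty compact set, on which the norm attains its minimum.\<close>

lemma exists_norm_minimal_exit:
  fixes p :: "complex \<Rightarrow> complex"
  assumes "continuous_on (ball 0 1) p" "open U" "z1 \<in> ball 0 1" "p z1 \<notin> U"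
  obtains z0 where "z0 \<in> ball 0 1" "p z0 \<notin> U" "\<And>z. norm z < norm z0 \<Longrightarrow> p z \<in> U"
proof -
  define K where "K = cball 0 (norm z1) \<inter> p -` (- U)"
  have "compact K"
    unfolding K_def compact_eq_bounded_closed
  proof
    show "closed (cball 0 (norm z1) \<inter> p -` (- U))"
      using assms by (intro continuous_closed_preimage continuous_on_subset[OF assms(1)]) auto
  qed (auto intro: bounded_subset[OF bounded_cball])
  moreover have "z1 \<in> K" using assms by (simp add: K_def)
  ultimately obtain z0 where z0: "z0 \<in> K" "\<And>z. z \<in> K \<Longrightarrow> norm z0 \<le> norm z"
    using continuous_attains_inf[of K norm] by (auto intro: continuous_intros)
  have "p z \<in> U" if "norm z < norm z0" for z
  proof (rule ccontr)
    assume "p z \<notin> U"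
    then have "z \<in> K" using that z0(1) by (simp add: K_def)
    with z0(2) that show False by force
  qed
  then show thesis using that[of z0] z0(1) assms(3) by (auto simp: K_def)
qed

lemma tendsto_if_subseq_limits_unique:
  fixes X :: "nat \<Rightarrow> 'a::metric_space"
  assumes "compact K" "range X \<subseteq> K"
    and uniq: "\<And>r l. strict_mono r \<Longrightarrow> (X \<circ> r) \<longlonglongrightarrow> l \<Longrightarrow> l = a"
  shows "X \<longlonglongrightarrow> a"
proof (rule ccontr)
  assume "\<not> X \<longlonglongrightarrow> a"
  then obtain e where e: "e > 0" "\<And>N. \<exists>n\<ge>N. e \<le> dist (X n) a"
    unfolding lim_sequentially by (metis not_le)
  then have "infinite {n. e \<le> dist (X n) a}"
    unfolding infinite_nat_iff_unbounded_le by auto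
  then obtain r :: "nat \<Rightarrow> nat" where r: "strict_mono r" "\<And>n. e \<le> dist (X (r n)) a"
    using infinite_enumerate by blast
  have "\<forall>n. (X \<circ> r) n \<in> K" using assms(2) by auto
  then obtain l r' where r': "strict_mono r'" "(X \<circ> r \<circ> r') \<longlonglongrightarrow> l"
    using assms(1) unfolding compact_def by blast
  have "l = a" using uniq[of "r \<circ> r'"] r r' strict_mono_o by (auto simp: o_assoc)
  then obtain n where "dist ((X \<circ> r \<circ> r') n) a < e"
    using r'(2) e(1) unfolding lim_sequentially by blast
  with r(2)[of "r' n"] show False by simp
qed

text \<open>A limit point in the exceptional set would force q (u k) to infinity, against the finite
  limit \<open>y\<close>. Elsewhere on the closed disc \<open>q\<close> is continuous, so q \<zeta>
  = y, and since \<open>y\<close> is not attained in the open disc, \<zeta> lies on the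
  circle.\<close>

lemma class_Q_boundary_limit:
  assumes q: "q \<in> class_Q" and u: "\<And>k::nat. u k \<in> unit_disc" "u \<longlonglongrightarrow> \<zeta>"
    and qu: "(\<lambda>k. q (u k)) \<longlonglongrightarrow> y" and y: "y \<notin> q ` unit_disc"
  shows "\<zeta> \<in> sphere 0 1 - exceptional_set q" "q \<zeta> = y"
proof -
  have ana: "q analytic_on (cball 0 1 - exceptional_set q)" using q by (simp add: class_Q_def)
  have "norm (u k) \<le> 1" for k using u(1)[of k] by simp
  then have "norm \<zeta> \<le> 1"
    by (intro tendsto_upperbound[OF tendsto_norm[OF u(2)]]) auto
  have notE: "\<zeta> \<notin> exceptional_set q"
  proof
    assume E: "\<zeta> \<in> exceptional_set q"
    then have "norm \<zeta> = 1" by (simp add: exceptional_set_def)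
    then have "u k \<noteq> \<zeta>" for k using u(1)[of k] by auto
    then have "filterlim u (at \<zeta> within unit_disc) sequentially"
      using u by (auto simp: filterlim_at)
    then have "filterlim (\<lambda>k. q (u k)) at_infinity sequentially"
      using E filterlim_compose by (auto simp: exceptional_set_def)
    then show False using not_tendsto_and_filterlim_at_infinity[OF _ qu] by simp
  qed
  then have "q analytic_on {\<zeta>}"
    using ana \<open>norm \<zeta> \<le> 1\<close> by (auto intro: analytic_on_subset)
  then have "isCont q \<zeta>" by (simp add: analytic_at_imp_isCont)
  then have "(\<lambda>k. q (u k)) \<longlonglongrightarrow> q \<zeta>" using u(2) isCont_tendsto_compose by blast
  then show "q \<zeta> = y" using qu LIMSEQ_unique by blast
  then have "\<zeta> \<notin> unit_disc" using y by auto
  then show "\<zeta> \<in> sphere 0 1 - exceptional_set q" using \<open>norm \<zeta> \<le> 1\<close> notE by simp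
qed

text \<open>The factor is P z = \<beta> + z g z, where \<open>g\<close> sums the tail of the series
  with z^(n+1) divided out.\<close>

lemma class_H_factor:
  assumes "p \<in> class_H \<beta> a n"
  obtains P where "P holomorphic_on unit_disc" "P 0 = of_real \<beta>"
    "\<And>z. z \<in> unit_disc \<Longrightarrow> p z = a + z ^ n * P z"
proof -
  obtain c where c: "\<And>z. z \<in> unit_disc \<Longrightarrow>
      (\<lambda>k. c k * z ^ (n + 1 + k)) sums (p z - (a + of_real \<beta> * z ^ n))"
    using assms unfolding class_H_def by blast
  define g where "g z = (\<Sum>k. c k * z ^ k)" for z
  have sums: "(\<lambda>k. c k * z ^ k) sums g z" if "z \<in> unit_disc" for z
  \<comment> \<open>Cancelling z^(n+1) requires z \<noteq> 0; at 0 a power series converges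
    trivially.\<close>
  proof (cases "z = 0")
    case False
    have "(\<lambda>k. z ^ (n + 1) * (c k * z ^ k)) sums (p z - (a + of_real \<beta> * z ^ n))"
      using c[OF that] by (simp add: power_add mult_ac)
    then have "summable (\<lambda>k. c k * z ^ k)"
      using False summable_mult_D sums_summable by (metis power_not_zero)
    then show ?thesis by (simp add: g_def summable_sums)
  next
    case True
    then show ?thesis unfolding g_def by (simp add: summable_sums)
  qed
  have eq: "p z - (a + of_real \<beta> * z ^ n) = z ^ (n + 1) * g z" if "z \<in> unit_disc" for z
  proof -
    have "(\<lambda>k. z ^ (n + 1) * (c k * z ^ k)) sums (z ^ (n + 1) * g z)"
      using sums[OF that] by (rule sums_mult)
    then show ?thesis using c[OF that] sums_unique2 by (force simp: power_add mult_ac)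
  qed
  show thesis
  proof
    show "(\<lambda>z. of_real \<beta> + z * g z) holomorphic_on unit_disc"
      using sums by (intro holomorphic_intros power_series_holomorphic) auto
    show "p z = a + z ^ n * (of_real \<beta> + z * g z)" if "z \<in> unit_disc" for z
      using eq[OF that] by (simp add: algebra_simps)
  qed simp
qed

lemma class_Q_disc:
  assumes "q \<in> class_Q"
  shows "q holomorphic_on unit_disc" "inj_on q unit_disc"
proof -
  have sub: "unit_disc \<subseteq> cball 0 1 - exceptional_set q"
    by (auto simp: exceptional_set_def)
  show "q holomorphic_on unit_disc"
    using assms sub by (auto simp: class_Q_def intro: analytic_imp_holomorphic analytic_on_subset)
  show "inj_on q unit_disc"
    using assms sub by (auto simp: class_Q_def intro: inj_on_subset)
qed

text \<open>Every cluster value of \<open>w\<close> at \<open>x\<close> is a boundary point where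
  \<open>q\<close> takes the value \<open>y\<close>. Injectivity of \<open>q\<close> off the
  exceptional set leaves only one such point, and compactness of the closed disc turns the unique
  cluster value into a limit.\<close>

lemma class_Q_inverse_boundary_limit:
  fixes w :: "complex \<Rightarrow> complex"
  assumes q: "q \<in> class_Q" and w: "w ` B \<subseteq> unit_disc"
    and qw: "((\<lambda>z. q (w z)) \<longlongrightarrow> y) (at x within B)" and y: "y \<notin> q ` unit_disc"
    and nontriv: "at x within B \<noteq> bot"
  obtains \<zeta> where "\<zeta> \<in> sphere 0 1 - exceptional_set q" "q \<zeta> = y" "(w \<longlongrightarrow> \<zeta>) (at x within B)"
proof -
  have lim: "l \<in> sphere 0 1 - exceptional_set q \<and> q l = y"
    if X: "\<And>i. X i \<in> B - {x}" "X \<longlonglongrightarrow> x" and r: "strict_mono r" "(w \<circ> X \<circ> r) \<longlonglongrightarrow> l"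
    for X l and r :: "nat \<Rightarrow> nat"
  proof -
    have "((\<lambda>z. q (w z)) \<circ> X) \<longlonglongrightarrow> y"
      using qw X unfolding tendsto_at_iff_sequentially by blast
    from LIMSEQ_subseq_LIMSEQ[OF this r(1)]
    have qu: "(\<lambda>k. q ((w \<circ> X \<circ> r) k)) \<longlonglongrightarrow> y"
      by (simp add: o_def)
    have "(w \<circ> X \<circ> r) k \<in> unit_disc" for k using w X(1)[of "r k"] by (auto simp del: mem_ball)
    from class_Q_boundary_limit[OF q this r(2) qu y] show ?thesis by blast
  qed
  \<comment> \<open>One sequence approaching \<open>x\<close> produces the candidate \<zeta>; every
    other sequence is compared with it afterwards.\<close>
  obtain X where X: "\<And>i::nat. X i \<in> B - {x}" "X \<longlonglongrightarrow> x"
    using nontriv unfolding trivial_limit_within islimpt_sequential by auto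
  have in_cball: "range (w \<circ> Y) \<subseteq> cball 0 1" if "\<And>i::nat. Y i \<in> B - {x}" for Y
  proof -
    have "w (Y i) \<in> unit_disc" for i using w that[of i] by blast
    then show ?thesis by (auto simp: less_imp_le)
  qed
  then have "\<forall>i. (w \<circ> X) i \<in> cball 0 1" using X by blast
  then obtain \<zeta> r where \<zeta>: "strict_mono r" "(w \<circ> X \<circ> r) \<longlonglongrightarrow> \<zeta>"
    using seq_compactE[OF compact_imp_seq_compact[OF compact_cball]] by blast
  have \<zeta>': "\<zeta> \<in> sphere 0 1 - exceptional_set q" "q \<zeta> = y" using lim[OF X \<zeta>] by auto
  have "(w \<longlongrightarrow> \<zeta>) (at x within B)"
    unfolding tendsto_at_iff_sequentially
  proof (intro allI impI)
    fix Y assume Y: "\<forall>i::nat. Y i \<in> B - {x}" "Y \<longlonglongrightarrow> x"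
    show "(w \<circ> Y) \<longlonglongrightarrow> \<zeta>"
    proof (rule tendsto_if_subseq_limits_unique[OF compact_cball in_cball])
      fix s l assume s: "strict_mono (s :: nat \<Rightarrow> nat)" "(w \<circ> Y \<circ> s) \<longlonglongrightarrow> l"
      have l: "l \<in> sphere 0 1 - exceptional_set q \<and> q l = y"
        using lim[OF _ Y(2) s] Y(1) by blast
      have "inj_on q (cball 0 1 - exceptional_set q)" using q by (simp add: class_Q_def)
      then show "l = \<zeta>" using l \<zeta>' by (auto simp: inj_on_def)
    qed (use Y in blast)
  qed
  with \<zeta>' show thesis using that by blast
qed

text \<open>Write q u - q 0 = u Q u. Here \<open>Q\<close> has no zeros: injectivity of
  \<open>q\<close> excludes them away from 0, and Q 0 = q'(0). Comparing with p z - q 0 = z^n P z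
  gives w Q(w) = z^n P, so \<phi> is P divided by Q(w).\<close>

lemma inverse_branch_zero_order:
  assumes q: "q holomorphic_on unit_disc" "inj_on q unit_disc" "deriv q 0 \<noteq> 0"
    and p: "p \<in> class_H \<beta> (q 0) n" and "0 < R" "R \<le> 1"
    and w: "w holomorphic_on ball 0 R" "w ` ball 0 R \<subseteq> unit_disc" "w 0 = 0"
    and qw: "\<And>z. z \<in> ball 0 R \<Longrightarrow> q (w z) = p z"
  obtains \<phi> where "\<phi> holomorphic_on ball 0 R" "\<phi> 0 = of_real \<beta> / deriv q 0"
    "\<And>z. z \<in> ball 0 R \<Longrightarrow> w z = z ^ n * \<phi> z"
proof -
  obtain P where P: "P holomorphic_on unit_disc" "P 0 = of_real \<beta>"
    "\<And>z. z \<in> unit_disc \<Longrightarrow> p z = q 0 + z ^ n * P z"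
    using class_H_factor[OF p] by metis
  have "(\<lambda>u. q u - q 0) holomorphic_on unit_disc" using q by (intro holomorphic_intros)
  then obtain Q where Q: "Q holomorphic_on unit_disc"
      "\<And>u. norm u < 1 \<Longrightarrow> q u - q 0 = u * Q u" "deriv (\<lambda>u. q u - q 0) 0 = Q 0"
    using Schwarz3[of "\<lambda>u. q u - q 0" 1] by (metis diff_self)
  have "(q has_field_derivative deriv q 0) (at 0)"
    using holomorphic_derivI[OF q(1)] by simp
  then have "((\<lambda>u. q u - q 0) has_field_derivative deriv q 0) (at 0)"
    by (auto intro!: derivative_eq_intros)
  then have Q0: "Q 0 = deriv q 0" using Q(3) DERIV_imp_deriv by metis
  have Qnz: "Q u \<noteq> 0" if "norm u < 1" for u
  proof (cases "u = 0")
    case False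
    then have "q u \<noteq> q 0" using that q(2) by (auto simp: inj_on_def)
    then show ?thesis using Q(2)[OF that] by auto
  qed (use Q0 q(3) in simp)
  show thesis
  proof
    have "(\<lambda>z. Q (w z)) holomorphic_on ball 0 R"
      using holomorphic_on_compose_gen[OF w(1) Q(1) w(2)] by (simp add: o_def)
    moreover have "P holomorphic_on ball 0 R"
      using \<open>R \<le> 1\<close> by (intro holomorphic_on_subset[OF P(1)]) auto
    moreover have "Q (w z) \<noteq> 0" if "z \<in> ball 0 R" for z
      using Qnz w(2) that by fastforce
    ultimately show "(\<lambda>z. P z / Q (w z)) holomorphic_on ball 0 R"
      by (intro holomorphic_intros)
    show "P 0 / Q (w 0) = of_real \<beta> / deriv q 0" using P(2) Q0 w(3) by simp
    show "w z = z ^ n * (P z / Q (w z))" if "z \<in> ball 0 R" for z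
    proof -
      have z: "z \<in> unit_disc" using that \<open>R \<le> 1\<close> by auto
      have wz: "norm (w z) < 1" using w(2) that by fastforce
      have "w z * Q (w z) = z ^ n * P z"
        using Q(2)[OF wz] P(3)[OF z] qw[OF that] by simp
      then show ?thesis using Qnz[OF wz] by (simp add: field_simps)
    qed
  qed
qed

section \<open>Jack's lemma and continuation across a boundary point\<close>

text \<open>A local form of Jack's lemma, with \<open>f\<close> given only near \<open>z0\<close>.
  The first-order condition on the circle makes z0 f' / f real at \<open>z0\<close>, the radial
  estimate bounds it from below, and the second-order condition divided by \<open>m\<close> gives
  the last inequality.\<close>

lemma Jack_lemma:
  fixes c :: real
  assumes f: "f holomorphic_on S" "open S" "z0 \<in> S" "norm (f z0) = 1"
    and circle: "\<And>z. z \<in> S \<Longrightarrow> norm z = norm z0 \<Longrightarrow> norm (f z) \<le> 1"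
    and "1 \<le> n" "0 \<le> c" "c \<le> 1"
    and radial: "eventually (\<lambda>x. norm (f (of_real x * z0)) \<le> x ^ n * ((x + c) / (1 + c * x))) (at_left 1)"
  obtains m :: real where "m \<ge> real n + (1 - c) / (1 + c)" "z0 * deriv f z0 = of_real m * f z0"
    "Re (z0\<^sup>2 * deriv (deriv f) z0 / (z0 * deriv f z0)) + 1 \<ge> m"
proof
  define m where "m = Re (cnj (f z0) * (z0 * deriv f z0))"
  show m: "m \<ge> real n + (1 - c) / (1 + c)"
    unfolding m_def using radial_derivative_lower_bound[OF f \<open>0 \<le> c\<close> radial] .
  have "0 \<le> (1 - c) / (1 + c)" using \<open>0 \<le> c\<close> \<open>c \<le> 1\<close> by simp
  \<comment> \<open>Positivity of \<open>m\<close> is what allows the later division by it.\<close>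
  then have "m > 0" using m \<open>1 \<le> n\<close> by linarith
  have unit: "f z0 * cnj (f z0) = 1"
    using f(4) by (simp add: complex_norm_square[symmetric])
  have circ: "\<And>z. z \<in> S \<Longrightarrow> norm z = norm z0 \<Longrightarrow> norm (f z) \<le> norm (f z0)"
    using circle f(4) by simp
  note max = norm_max_on_circle[OF f(1-3) circ]
  have "cnj (f z0) * (z0 * deriv f z0) = of_real m"
    using max(1) by (simp add: complex_eq_iff m_def)
  then have "f z0 * (cnj (f z0) * (z0 * deriv f z0)) = f z0 * of_real m" by simp
  then show zf: "z0 * deriv f z0 = of_real m * f z0"
    using unit by (metis mult.assoc mult.commute mult_1)
  \<comment> \<open>Since |f z0| = 1, dividing by \<open>f z0\<close> is multiplying by its
    conjugate; hence s / m is the quotient in the conclusion.\<close>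
  define s where "s = cnj (f z0) * (z0\<^sup>2 * deriv (deriv f) z0)"
  have "norm (z0 * deriv f z0) = m" using zf f(4) \<open>m > 0\<close> by (simp add: norm_mult)
  then have "m\<^sup>2 \<le> m + Re s"
    using max(2) by (simp add: s_def m_def distrib_left)
  then have "m \<le> Re s / m + 1"
    using \<open>m > 0\<close> by (simp add: field_simps power2_eq_square)
  moreover have "z0\<^sup>2 * deriv (deriv f) z0 / (z0 * deriv f z0) = s / of_real m"
  proof -
    have "f z0 \<noteq> 0" using f(4) by auto
    have "s / of_real m = (f z0 * cnj (f z0)) * (z0\<^sup>2 * deriv (deriv f) z0) / (of_real m * f z0)"
      using \<open>f z0 \<noteq> 0\<close> unfolding s_def by simp
    then show ?thesis using unit zf by simp
  qed
  ultimately show "Re (z0\<^sup>2 * deriv (deriv f) z0 / (z0 * deriv f z0)) + 1 \<ge> m"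
    by (simp only: Re_divide_of_real)
qed

lemma deriv_compose_twice:
  assumes "open S" "f holomorphic_on S" "z \<in> S" "q holomorphic_on T" "open T" "f ` S \<subseteq> T"
    and p: "\<And>x. x \<in> S \<Longrightarrow> p x = q (f x)"
  shows "deriv p z = deriv q (f z) * deriv f z"
    and "deriv (deriv p) z =
           deriv (deriv q) (f z) * (deriv f z)\<^sup>2 + deriv q (f z) * deriv (deriv f) z"
proof -
  have d1: "deriv p x = deriv q (f x) * deriv f x" if "x \<in> S" for x
  proof -
    have "((q \<circ> f) has_field_derivative deriv q (f x) * deriv f x) (at x)"
      using holomorphic_derivI[OF assms(4,5)] holomorphic_derivI[OF assms(2,1) that] assms(6) that
      by (intro DERIV_chain) auto
    then have "(p has_field_derivative deriv q (f x) * deriv f x) (at x)"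
      using has_field_derivative_transform_within_open[OF _ \<open>open S\<close> that] p by (auto simp: o_def)
    then show ?thesis by (rule DERIV_imp_deriv)
  qed
  then show "deriv p z = deriv q (f z) * deriv f z" using assms(3) .
  have fz: "f z \<in> T" using assms(3,6) by auto
  have "((\<lambda>x. deriv q (f x)) has_field_derivative deriv (deriv q) (f z) * deriv f z) (at z)"
    using DERIV_chain2[OF holomorphic_derivI[OF holomorphic_deriv[OF assms(4,5)] assms(5) fz]
        holomorphic_derivI[OF assms(2,1,3)]] .
  moreover have "(deriv f has_field_derivative deriv (deriv f) z) (at z)"
    using holomorphic_derivI[OF holomorphic_deriv[OF assms(2,1)] assms(1,3)] .
  ultimately have "((\<lambda>x. deriv q (f x) * deriv f x) has_field_derivative
      deriv (deriv q) (f z) * deriv f z * deriv f z + deriv (deriv f) z * deriv q (f z)) (at z)"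
    by (rule DERIV_mult)
  then have "(deriv p has_field_derivative
      deriv (deriv q) (f z) * deriv f z * deriv f z + deriv (deriv f) z * deriv q (f z)) (at z)"
    using has_field_derivative_transform_within_open[OF _ \<open>open S\<close> assms(3)] d1 by fastforce
  then show "deriv (deriv p) z =
      deriv (deriv q) (f z) * (deriv f z)\<^sup>2 + deriv q (f z) * deriv (deriv f) z"
    using DERIV_imp_deriv by (fastforce simp: power2_eq_square algebra_simps)
qed

text \<open>The continuation is g (p z), with \<open>g\<close> inverse to \<open>q\<close> on a
  small disc about \<zeta>. As \<open>w\<close> tends to \<zeta>, its values near \<open>z0\<close>
  lie in that disc, where g (q (w z)) = w z.\<close>

lemma local_inverse_lift:
  assumes q: "q holomorphic_on T" "open T" "\<zeta> \<in> T" "deriv q \<zeta> \<noteq> 0"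
    and p: "p holomorphic_on B" "open B" "z0 \<in> B" "p z0 = q \<zeta>"
    and w: "(w \<longlongrightarrow> \<zeta>) (at z0 within A)" "\<And>z. z \<in> A \<Longrightarrow> q (w z) = p z"
  obtains f S where "open S" "z0 \<in> S" "S \<subseteq> B" "f holomorphic_on S" "f ` S \<subseteq> T" "f z0 = \<zeta>"
    "\<And>z. z \<in> S \<Longrightarrow> p z = q (f z)" "\<And>z. z \<in> S \<Longrightarrow> z \<in> A \<Longrightarrow> z \<noteq> z0 \<Longrightarrow> f z = w z"
proof -
  obtain r where r: "r > 0" "ball \<zeta> r \<subseteq> T" "open (q ` ball \<zeta> r)" "inj_on q (ball \<zeta> r)"
    using has_complex_derivative_locally_invertible[OF q(1,3,2,4)] by metis
  have "q holomorphic_on ball \<zeta> r" using r(2) q(1) holomorphic_on_subset by blast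
  then obtain g where g: "g holomorphic_on q ` ball \<zeta> r" "\<And>u. u \<in> ball \<zeta> r \<Longrightarrow> g (q u) = u"
    using holomorphic_has_inverse[OF _ open_ball r(4)] by metis
  have "eventually (\<lambda>z. w z \<in> ball \<zeta> r) (at z0 within A)"
    using w(1) r(1) by (intro topological_tendstoD) auto
  then obtain e where e: "e > 0" "\<And>z. z \<in> A \<Longrightarrow> z \<noteq> z0 \<Longrightarrow> dist z z0 < e \<Longrightarrow> w z \<in> ball \<zeta> r"
    unfolding eventually_at by blast
  \<comment> \<open>The first factor brings p z into the domain of \<open>g\<close>; the second
    keeps w z within the disc on which \<open>g\<close> inverts \<open>q\<close>.\<close>
  define S where "S = (B \<inter> p -` (q ` ball \<zeta> r)) \<inter> ball z0 e"
  have "open (B \<inter> p -` (q ` ball \<zeta> r))"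
    using p(1,2) r(3) by (intro continuous_open_preimage holomorphic_on_imp_continuous_on)
  then have "open S" by (simp add: S_def open_Int)
  have pS: "p ` S \<subseteq> q ` ball \<zeta> r" by (auto simp: S_def)
  have gS: "g (p z) \<in> ball \<zeta> r \<and> q (g (p z)) = p z" if "z \<in> S" for z
    using pS that g(2) by (force simp: image_subset_iff)
  show thesis
  proof
    show "open S" by fact
    show "z0 \<in> S" using p(3,4) r(1) e(1) by (auto simp: S_def)
    show "S \<subseteq> B" by (auto simp: S_def)
    then have "p holomorphic_on S" using p(1) holomorphic_on_subset by blast
    then have "(g \<circ> p) holomorphic_on S"
      using g(1) pS by (rule holomorphic_on_compose_gen)
    then show "(\<lambda>z. g (p z)) holomorphic_on S" by (simp add: o_def)
    show "(\<lambda>z. g (p z)) ` S \<subseteq> T" using gS r(2) by blast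
    show "g (p z0) = \<zeta>" using g(2)[of \<zeta>] r(1) p(4) by simp
    show "p z = q (g (p z))" if "z \<in> S" for z using gS[OF that] by simp
    show "g (p z) = w z" if "z \<in> S" "z \<in> A" "z \<noteq> z0" for z
      using g(2)[OF e(2)[of z]] w(2)[of z] that by (simp add: S_def dist_commute)
  qed
qed

section \<open>The contact point and the subordination\<close>

lemma Miller_Mocanu_contact:
  assumes q: "q \<in> class_Q" and p: "p \<in> class_H \<beta> (q 0) n" and "1 \<le> n"
    and \<beta>: "0 < \<beta>" "\<beta> \<le> norm (deriv q 0)"
    and exit: "\<not> p ` unit_disc \<subseteq> q ` unit_disc"
  obtains z0 \<zeta> and m :: real where "z0 \<in> unit_disc" "\<zeta> \<in> sphere 0 1 - exceptional_set q"
    "m \<ge> real n + (norm (deriv q 0) - \<beta>) / (norm (deriv q 0) + \<beta>)"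
    "p z0 = q \<zeta>" "z0 * deriv p z0 = of_real m * \<zeta> * deriv q \<zeta>"
    "Re (z0\<^sup>2 * deriv (deriv p) z0 / (z0 * deriv p z0) + 1) \<ge>
       m * Re (\<zeta> * deriv (deriv q) \<zeta> / deriv q \<zeta> + 1)"
proof -
  note qD = class_Q_disc[OF q]
  have qana: "q analytic_on (cball 0 1 - exceptional_set q)"
    and qnz: "\<And>\<zeta>. \<zeta> \<in> sphere 0 1 - exceptional_set q \<Longrightarrow> deriv q \<zeta> \<noteq> 0"
    using q by (auto simp: class_Q_def)
  have q0: "deriv q 0 \<noteq> 0" using \<beta> by auto
  have holp: "p holomorphic_on unit_disc" using p by (simp add: class_H_def)
  have contp: "continuous_on unit_disc p" using holp by (rule holomorphic_on_imp_continuous_on)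
  have "open (q ` unit_disc)" using open_mapping_thm3[OF qD(1) open_ball qD(2)] .
  then obtain z0 where z0: "z0 \<in> unit_disc" "p z0 \<notin> q ` unit_disc"
      "\<And>z. norm z < norm z0 \<Longrightarrow> p z \<in> q ` unit_disc"
    using exit exists_norm_minimal_exit[OF contp] by (metis image_subset_iff)
  obtain P where "\<And>z. z \<in> unit_disc \<Longrightarrow> p z = q 0 + z ^ n * P z"
    using class_H_factor[OF p] by metis
  then have p0: "p 0 = q 0" using \<open>1 \<le> n\<close> by simp
  define R where "R = norm z0"
  \<comment> \<open>The origin is no exit point, because p 0 = q 0 is a value of \<open>q\<close> on
    the disc.\<close>
  have "z0 \<noteq> 0" using z0(2) p0 by auto
  then have R: "0 < R" "R \<le> 1" using z0(1) by (auto simp: R_def)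
  define A where "A = ball (0::complex) R"
  obtain g where g: "g holomorphic_on q ` unit_disc" "\<And>u. u \<in> unit_disc \<Longrightarrow> g (q u) = u"
    using holomorphic_has_inverse[OF qD(1) open_ball qD(2)] by metis
  define w where "w z = g (p z)" for z
  have pA: "p ` A \<subseteq> q ` unit_disc" using z0(3) by (auto simp: A_def R_def)
  have w: "w z \<in> unit_disc" "q (w z) = p z" if "z \<in> A" for z
    using pA that g(2) by (force simp: w_def image_subset_iff)+
  have AD: "A \<subseteq> unit_disc" using R by (auto simp: A_def)
  have holw: "w holomorphic_on A"
    using holomorphic_on_compose_gen[OF holomorphic_on_subset[OF holp AD] g(1) pA]
    by (simp add: w_def[abs_def] o_def)
  have wA: "w ` A \<subseteq> unit_disc" using w by blast
  have "w 0 = 0" using g(2)[of 0] p0 by (simp add: w_def)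
  then obtain \<phi> where \<phi>: "\<phi> holomorphic_on A" "\<phi> 0 = of_real \<beta> / deriv q 0"
    "\<And>z. z \<in> A \<Longrightarrow> w z = z ^ n * \<phi> z"
    using inverse_branch_zero_order[OF qD q0 p R holw[unfolded A_def] wA[unfolded A_def]] w(2)
    unfolding A_def by metis
  \<comment> \<open>This is the modulus of \<phi> 0; it turns (1 - c) / (1 + c) into the fraction in
    the admissibility bound.\<close>
  define c where "c = \<beta> / norm (deriv q 0)"
  have c: "0 \<le> c" "c \<le> 1" using \<beta> by (auto simp: c_def divide_le_eq)
  have growth: "norm (w z) \<le> (norm z / R) ^ n * ((norm z / R + c) / (1 + c * (norm z / R)))"
    if "z \<in> A" for z
    unfolding \<phi>(3)[OF that]
  proof (rule growth_bound_zero_order[OF \<phi>(1)[unfolded A_def] R])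
    show "norm (u ^ n * \<phi> u) \<le> 1" if "norm u < R" for u
      using w(1)[of u] \<phi>(3)[of u] that by (simp add: A_def less_imp_le)
    show "norm (\<phi> 0) \<le> c" using \<beta> by (simp add: \<phi>(2) c_def norm_divide)
  qed (use c that in \<open>auto simp: A_def\<close>)
  have lim: "z0 islimpt A"
    using R by (simp add: A_def R_def islimpt_ball)
  have "(p \<longlongrightarrow> p z0) (at z0 within A)"
    using contp z0(1) continuous_on_subset[OF contp AD]
    by (meson AD continuous_on_def tendsto_within_subset)
  then have "((\<lambda>z. q (w z)) \<longlongrightarrow> p z0) (at z0 within A)"
    by (rule Lim_transform_eventually) (auto simp: eventually_at_filter w(2))
  then obtain \<zeta> where \<zeta>: "\<zeta> \<in> sphere 0 1 - exceptional_set q" "q \<zeta> = p z0" "(w \<longlongrightarrow> \<zeta>) (at z0 within A)"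
    using class_Q_inverse_boundary_limit[OF q wA _ z0(2)] lim by (metis trivial_limit_within)
  obtain T where T: "open T" "\<zeta> \<in> T" "q holomorphic_on T"
    using qana \<zeta>(1) by (metis Diff_iff analytic_on_def centre_in_ball open_ball mem_cball mem_sphere order_refl)
  obtain f S where f: "open S" "z0 \<in> S" "S \<subseteq> unit_disc" "f holomorphic_on S" "f ` S \<subseteq> T" "f z0 = \<zeta>"
      and pqf: "\<And>z. z \<in> S \<Longrightarrow> p z = q (f z)"
      and fw: "\<And>z. z \<in> S \<Longrightarrow> z \<in> A \<Longrightarrow> z \<noteq> z0 \<Longrightarrow> f z = w z"
    using local_inverse_lift[OF T(3,1,2) qnz[OF \<zeta>(1)] holp open_ball z0(1) \<zeta>(2)[symmetric] \<zeta>(3) w(2)]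
    by metis
  \<comment> \<open>Points of \<open>S\<close> on the circle |z| = R lie outside \<open>A\<close>,
    where \<open>w\<close> is controlled. Approaching them radially from inside \<open>A\<close>
    lets bounds on \<open>w\<close> pass to \<open>f\<close>.\<close>
  have near: "eventually (\<lambda>x. of_real x * z \<in> S \<and> of_real x * z \<in> A \<and> of_real x * z \<noteq> z0 \<and> 0 < x) (at_left (1::real))"
    if "z \<in> S" "norm z = R" for z
  proof -
    have "((\<lambda>x. of_real x * z) \<longlongrightarrow> of_real 1 * z) (at_left (1::real))"
      by (intro tendsto_intros)
    then have "eventually (\<lambda>x. of_real x * z \<in> S) (at_left (1::real))"
      using f(1) that by (intro topological_tendstoD) auto
    moreover have "eventually (\<lambda>x. x \<in> {0<..<1}) (at_left (1::real))"
      by (intro eventually_at_leftI[of 0]) auto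
    ultimately show ?thesis
    proof eventually_elim
      case (elim x)
      then have "norm (of_real x * z) < R" using that R by (simp add: norm_mult)
      with elim show ?case by (auto simp: A_def R_def)
    qed
  qed
  have circle: "norm (f z) \<le> 1" if z: "z \<in> S" "norm z = norm z0" for z
  proof (rule tendsto_upperbound)
    have "isCont f z"
      using f(1,4) z(1) by (meson continuous_on_eq_continuous_at holomorphic_on_imp_continuous_on)
    moreover have "((\<lambda>x. of_real x * z) \<longlongrightarrow> of_real 1 * z) (at_left (1::real))"
      by (intro tendsto_intros)
    ultimately show "((\<lambda>x. norm (f (of_real x * z))) \<longlongrightarrow> norm (f z)) (at_left (1::real))"
      by (intro tendsto_norm isCont_tendsto_compose[of z f]) auto
    show "eventually (\<lambda>x. norm (f (of_real x * z)) \<le> 1) (at_left (1::real))"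
      using near[OF z(1) z(2)[folded R_def]]
    proof eventually_elim
      case (elim x)
      then show ?case using w(1)[of "of_real x * z"] by (simp add: fw)
    qed
  qed simp
  have radial: "eventually (\<lambda>x. norm (f (of_real x * z0)) \<le> x ^ n * ((x + c) / (1 + c * x))) (at_left 1)"
    using near[OF f(2) R_def[symmetric]]
  proof eventually_elim
    case (elim x)
    then show ?case
      using growth[of "of_real x * z0"] R by (simp add: fw norm_mult R_def)
  qed
  have "norm (f z0) = 1" using f(6) \<zeta>(1) by simp
  then obtain m :: real where m: "m \<ge> real n + (1 - c) / (1 + c)" "z0 * deriv f z0 = of_real m * \<zeta>"
    "Re (z0\<^sup>2 * deriv (deriv f) z0 / (z0 * deriv f z0)) + 1 \<ge> m"
    using Jack_lemma[OF f(4,1,2) _ circle \<open>1 \<le> n\<close> c radial] f(6) by metis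
  have "(1 - c) / (1 + c) = (norm (deriv q 0) - \<beta>) / (norm (deriv q 0) + \<beta>)"
  proof -
    have pos: "norm (deriv q 0) > 0" using q0 by simp
    then have "(1 - c) / (1 + c) = ((1 - c) * norm (deriv q 0)) / ((1 + c) * norm (deriv q 0))"
      by simp
    moreover have "c * norm (deriv q 0) = \<beta>" using pos by (simp add: c_def)
    ultimately show ?thesis by (simp add: algebra_simps)
  qed
  moreover have "0 \<le> (1 - c) / (1 + c)" using c by simp
  ultimately have m': "m \<ge> real n + (norm (deriv q 0) - \<beta>) / (norm (deriv q 0) + \<beta>)" "m > 0"
    using m(1) \<open>1 \<le> n\<close> by linarith+
  note chain = deriv_compose_twice[OF f(1,4,2) T(3,1) f(5) pqf, unfolded f(6)]
  have zp: "z0 * deriv p z0 = of_real m * \<zeta> * deriv q \<zeta>"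
    using chain(1) m(2) by (simp add: mult_ac)
  have "z0\<^sup>2 * deriv (deriv p) z0 =
      deriv (deriv q) \<zeta> * (z0 * deriv f z0)\<^sup>2 + deriv q \<zeta> * (z0\<^sup>2 * deriv (deriv f) z0)"
    by (simp add: chain(2) algebra_simps power2_eq_square)
  moreover have "\<zeta> \<noteq> 0" using \<zeta>(1) by auto
  \<comment> \<open>Substituting z0 f' = m \<zeta> makes the first summand, divided by m \<zeta>
    q'(\<zeta>), equal to m \<zeta> q'' / q'.\<close>
  ultimately have "z0\<^sup>2 * deriv (deriv p) z0 / (z0 * deriv p z0) =
      of_real m * (\<zeta> * deriv (deriv q) \<zeta> / deriv q \<zeta>) +
      z0\<^sup>2 * deriv (deriv f) z0 / (z0 * deriv f z0)"
    unfolding zp m(2) using qnz[OF \<zeta>(1)] \<open>m > 0\<close> by (simp add: field_simps power2_eq_square)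
  moreover have Re_lin: "Re (of_real m * u + v + 1) = m * Re u + (Re v + 1)" for u v
    by simp
  ultimately have "Re (z0\<^sup>2 * deriv (deriv p) z0 / (z0 * deriv p z0) + 1) =
      m * Re (\<zeta> * deriv (deriv q) \<zeta> / deriv q \<zeta>) +
      (Re (z0\<^sup>2 * deriv (deriv f) z0 / (z0 * deriv f z0)) + 1)"
    by (simp only: Re_lin)
  \<comment> \<open>The lower bound \<open>m\<close> for the last bracket supplies the summand m * 1
    on the right.\<close>
  then have "Re (z0\<^sup>2 * deriv (deriv p) z0 / (z0 * deriv p z0) + 1) \<ge>
       m * Re (\<zeta> * deriv (deriv q) \<zeta> / deriv q \<zeta> + 1)"
    using m(3) by (simp add: distrib_left)
  then show thesis using that z0(1) \<zeta>(1) m'(1) \<zeta>(2) zp by metis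
qed

theorem theorem3p2:
  fixes n :: nat and \<beta> :: real and a :: complex
    and \<Omega> :: "complex set" and h q p :: "complex \<Rightarrow> complex"
    and \<psi> :: "complex \<times> complex \<times> complex \<Rightarrow> complex"
    and D :: "(complex \<times> complex \<times> complex) set"
  assumes "n \<ge> 1"
    and "is_domain \<Omega>" and "simply_connected \<Omega>" and "\<Omega> \<noteq> UNIV"
    and "conformal_map_onto h \<Omega>"
    and "q \<in> class_Q" and "q 0 = a"
    and "0 < \<beta>" and "\<beta> \<le> norm (deriv q 0)"
    and "\<psi> \<in> admissible_class_conformal n \<beta> h q D"
    and "p \<in> class_H \<beta> a n"
    and "\<forall>z\<in>unit_disc. (p z, z * deriv p z, z\<^sup>2 * deriv (deriv p) z) \<in> D"
    and "(\<lambda>z. \<psi> (p z, z * deriv p z, z\<^sup>2 * deriv (deriv p) z)) \<prec>\<^sub>s h"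
  shows "p \<prec>\<^sub>s q"
proof -
  note qD = class_Q_disc[OF \<open>q \<in> class_Q\<close>]
  have holp: "p holomorphic_on unit_disc"
    using \<open>p \<in> class_H \<beta> a n\<close> by (simp add: class_H_def)
  obtain P where "\<And>z. z \<in> unit_disc \<Longrightarrow> p z = a + z ^ n * P z"
    using class_H_factor[OF \<open>p \<in> class_H \<beta> a n\<close>] by metis
  then have p0: "p 0 = q 0" using \<open>n \<ge> 1\<close> \<open>q 0 = a\<close> by simp
  have range: "p ` unit_disc \<subseteq> q ` unit_disc"
  proof (rule ccontr)
    assume exit: "\<not> p ` unit_disc \<subseteq> q ` unit_disc"
    have "p \<in> class_H \<beta> (q 0) n" using assms by simp
    from Miller_Mocanu_contact[OF \<open>q \<in> class_Q\<close> this \<open>n \<ge> 1\<close> assms(8,9) exit]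
    obtain z0 \<zeta> and m :: real where z0: "z0 \<in> unit_disc"
      and contact: "\<zeta> \<in> sphere 0 1 - exceptional_set q"
        "m \<ge> real n + (norm (deriv q 0) - \<beta>) / (norm (deriv q 0) + \<beta>)"
        "p z0 = q \<zeta>" "z0 * deriv p z0 = of_real m * \<zeta> * deriv q \<zeta>"
        "Re (z0\<^sup>2 * deriv (deriv p) z0 / (z0 * deriv p z0) + 1) \<ge>
           m * Re (\<zeta> * deriv (deriv q) \<zeta> / deriv q \<zeta> + 1)"
      by metis
    have "(p z0, z0 * deriv p z0, z0\<^sup>2 * deriv (deriv p) z0) \<in> D" using assms(12) z0 by blast
    moreover have "\<forall>r s t \<zeta>. \<forall>m::real.
        (r, s, t) \<in> D \<and> \<zeta> \<in> sphere 0 1 - exceptional_set q \<and>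
        m \<ge> real n + (norm (deriv q 0) - \<beta>) / (norm (deriv q 0) + \<beta>) \<and>
        r = q \<zeta> \<and> s = of_real m * \<zeta> * deriv q \<zeta> \<and>
        Re (t / s + 1) \<ge> m * Re (\<zeta> * deriv (deriv q) \<zeta> / deriv q \<zeta> + 1)
        \<longrightarrow> \<psi> (r, s, t) \<notin> h ` unit_disc"
      using assms(10) unfolding admissible_class_conformal_def admissible_class_def by blast
    \<comment> \<open>Admissibility is used with r, s, t equal to the three arguments of \<psi> at
      \<open>z0\<close>. The subordination to \<open>h\<close> says the opposite.\<close>
    ultimately have "\<psi> (p z0, z0 * deriv p z0, z0\<^sup>2 * deriv (deriv p) z0) \<notin> h ` unit_disc"
      using contact by blast
    moreover have "\<psi> (p z0, z0 * deriv p z0, z0\<^sup>2 * deriv (deriv p) z0) \<in> h ` unit_disc"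
      using assms(13) z0 unfolding subordinate_def by fastforce
    ultimately show False by contradiction
  qed
  \<comment> \<open>With the image of \<open>p\<close> inside that of \<open>q\<close>, the function
    g (p z) is the Schwarz function required by the subordination.\<close>
  obtain g where g: "g holomorphic_on q ` unit_disc" "\<And>u. u \<in> unit_disc \<Longrightarrow> g (q u) = u"
    using holomorphic_has_inverse[OF qD(1) open_ball qD(2)] by metis
  have "(g \<circ> p) holomorphic_on unit_disc"
    using holomorphic_on_compose_gen[OF holp g(1) range] .
  moreover have "(g \<circ> p) 0 = 0" using g(2)[of 0] p0 by simp
  moreover have "(g \<circ> p) z \<in> unit_disc \<and> p z = q ((g \<circ> p) z)" if "z \<in> unit_disc" for z
    using range that g(2) by (force simp: image_subset_iff)
  ultimately show ?thesis
    unfolding subordinate_def using holp qD(1) by blast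
qed

end
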